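(* Let $\Lambda$ be a finite, locally convex $k$-graph that has no cycle with an entrance. Then for each initial cycle $\mu\in \mathrm{IC}(\Lambda)$, $$\ell_\mu=|\{i\le k: d(\mu)_i>0\}|.$$
   Context: A $k$-graph ($k\ge1$) is a nonempty countable small category $\Lambda$ with a functor $d:\Lambda\to\mathbb{N}^k$ such that whenever $d(\lambda)=m+n$ there are unique $\mu,\nu\in\Lambda$ with $d(\mu)=m$, $d(\nu)=n$, $\lambda=\mu\nu$. $\Lambda^n:=d^{-1}(n)$; $\Lambda^0$ (the vertices) is identified with the objects; $r(\lambda),s(\lambda)$ are the codomain and domain of $\lambda$; $e_1,\dots,e_k$ are the generators of $\mathbb{N}^k$. For $v\in\Lambda^0$, $E\subseteq\Lambda$: $vE=\{\nu\in E: r(\nu)=v\}$. $\Lambda$ is finite if $|\Lambda^n|<\infty$ for all $n$; locally convex if for all $i\ne j$, $\lambda\in\Lambda^{e_i}$, $\mu\in\Lambda^{e_j}$ with $r(\lambda)=r(\mu)$, the sets $s(\lambda)\Lambda^{e_j}$ and $s(\mu)\Lambda^{e_i}$ are nonempty. For $m\le n\le d(\lambda)$, $\lambda(m,n)$ is the unique element of $\Lambda^{n-m}$ with $\lambda=\lambda'\lambda(m,n)\lambda''$ where $d(\lambda')=m$, $d(\lambda'')=d(\lambda)-n$; $\lambda(m):=\lambda(m,m)$. The same notation is used for (possibly infinite) paths of degree $m\in(\mathbb{N}\cup\{\infty\})^k$, i.e. degree-preserving functors $x:\{(p,q)\in\mathbb{N}^k\times\mathbb{N}^k:p\le q\le m\}\to\Lambda$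 (where $(p,q)$ has range $p$, source $q$, degree $q-p$). For a path $\tau$ with $r(\tau)=s(\tau)$, $\tau^\infty=\tau\tau\tau\cdots$ is the path with $d(\tau^\infty)_i=\infty$ if $d(\tau)_i>0$, $d(\tau^\infty)_i=0$ if $d(\tau)_i=0$, and $\tau^\infty(n\,d(\tau),(n+1)d(\tau))=\tau$ for all $n\in\mathbb{N}$. A cycle is $\lambda\in\Lambda\setminus\Lambda^0$ with $r(\lambda)=s(\lambda)$; it has an entrance if there is $\tau\in r(\lambda)\Lambda$ with $d(\tau)\le d(\lambda^\infty)$ and $\tau\ne\lambda^\infty(0,d(\tau))$. For $\Lambda$ with no cycle with an entrance, an initial cycle is $\mu\in\Lambda$ (possibly a vertex) with $r(\mu)=s(\mu)$ and $r(\mu)\Lambda^{e_i}=\emptyset$ whenever $d(\mu)_i=0$; $\mathrm{IC}(\Lambda)$ is the set of these. $G_\mu:=\{m-n: m,n\in\mathbb{N}^k,\ m,n\le d(\mu^\infty),\ \mu^\infty(m)=\mu^\infty(n)\}$ if $\mu$ is not a vertex, and $G_\mu:=\{0\}$ otherwise; this is a subgroup of $\mathbb{Z}^k$, and $\ell_\mu$ denotes its rank, i.e. $G_\mu\cong\mathbb{Z}^{\ell_\mu}$. *)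

theory Defs
  imports
    "HOL-Analysis.Finite_Cartesian_Product"
    "HOL-Algebra.Free_Abelian_Groups"
    "HOL-Library.Extended_Nat"
    "HOL-Library.Countable_Set"
begin

text \<open>
  Small categories are presented by their arrows: an object is identified with its identity arrow,
  so \<open>rng \<alpha>\<close> (codomain) and \<open>src \<alpha>\<close> (domain) are again arrows. The composite \<open>cmp \<mu> \<nu>\<close> is
  \<open>\<mu>\<nu>\<close> and is meaningful only when \<open>src \<mu> = rng \<nu>\<close>. The monoid \<open>\<nat>\<^sup>k\<close> is the type \<open>nat ^ 'k\<close> with
  \<open>k = CARD('k) \<ge> 1\<close>.
\<close>

record ('a, 'k) kgraph =
  Mor :: "'a set"
  rng :: "'a \<Rightarrow> 'a"
  src :: "'a \<Rightarrow> 'a"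
  cmp :: "'a \<Rightarrow> 'a \<Rightarrow> 'a"
  dgr :: "'a \<Rightarrow> nat ^ 'k"

locale small_category =
  fixes \<Lambda> :: "('a, 'k::finite) kgraph"
  assumes rng_in: "\<alpha> \<in> Mor \<Lambda> \<Longrightarrow> rng \<Lambda> \<alpha> \<in> Mor \<Lambda>"
    and src_in: "\<alpha> \<in> Mor \<Lambda> \<Longrightarrow> src \<Lambda> \<alpha> \<in> Mor \<Lambda>"
    and rng_rng: "\<alpha> \<in> Mor \<Lambda> \<Longrightarrow> rng \<Lambda> (rng \<Lambda> \<alpha>) = rng \<Lambda> \<alpha>"
    and src_rng: "\<alpha> \<in> Mor \<Lambda> \<Longrightarrow> src \<Lambda> (rng \<Lambda> \<alpha>) = rng \<Lambda> \<alpha>"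
    and rng_src: "\<alpha> \<in> Mor \<Lambda> \<Longrightarrow> rng \<Lambda> (src \<Lambda> \<alpha>) = src \<Lambda> \<alpha>"
    and src_src: "\<alpha> \<in> Mor \<Lambda> \<Longrightarrow> src \<Lambda> (src \<Lambda> \<alpha>) = src \<Lambda> \<alpha>"
    and cmp_in: "\<lbrakk>\<mu> \<in> Mor \<Lambda>; \<nu> \<in> Mor \<Lambda>; src \<Lambda> \<mu> = rng \<Lambda> \<nu>\<rbrakk> \<Longrightarrow> cmp \<Lambda> \<mu> \<nu> \<in> Mor \<Lambda>"
    and rng_cmp: "\<lbrakk>\<mu> \<in> Mor \<Lambda>; \<nu> \<in> Mor \<Lambda>; src \<Lambda> \<mu> = rng \<Lambda> \<nu>\<rbrakk> \<Longrightarrow> rng \<Lambda> (cmp \<Lambda> \<mu> \<nu>) = rng \<Lambda> \<mu>"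
    and src_cmp: "\<lbrakk>\<mu> \<in> Mor \<Lambda>; \<nu> \<in> Mor \<Lambda>; src \<Lambda> \<mu> = rng \<Lambda> \<nu>\<rbrakk> \<Longrightarrow> src \<Lambda> (cmp \<Lambda> \<mu> \<nu>) = src \<Lambda> \<nu>"
    and cmp_rng: "\<alpha> \<in> Mor \<Lambda> \<Longrightarrow> cmp \<Lambda> (rng \<Lambda> \<alpha>) \<alpha> = \<alpha>"
    and cmp_src: "\<alpha> \<in> Mor \<Lambda> \<Longrightarrow> cmp \<Lambda> \<alpha> (src \<Lambda> \<alpha>) = \<alpha>"
    and cmp_assoc: "\<lbrakk>\<alpha> \<in> Mor \<Lambda>; \<mu> \<in> Mor \<Lambda>; \<nu> \<in> Mor \<Lambda>;
        src \<Lambda> \<alpha> = rng \<Lambda> \<mu>; src \<Lambda> \<mu> = rng \<Lambda> \<nu>\<rbrakk> \<Longrightarrow>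
        cmp \<Lambda> (cmp \<Lambda> \<alpha> \<mu>) \<nu> = cmp \<Lambda> \<alpha> (cmp \<Lambda> \<mu> \<nu>)"

locale k_graph = small_category \<Lambda> for \<Lambda> :: "('a, 'k::finite) kgraph" +
  assumes nonempty: "Mor \<Lambda> \<noteq> {}"
    and countable_Mor: "countable (Mor \<Lambda>)"
    and dgr_id: "\<alpha> \<in> Mor \<Lambda> \<Longrightarrow> dgr \<Lambda> (rng \<Lambda> \<alpha>) = 0"
    and dgr_cmp: "\<lbrakk>\<mu> \<in> Mor \<Lambda>; \<nu> \<in> Mor \<Lambda>; src \<Lambda> \<mu> = rng \<Lambda> \<nu>\<rbrakk> \<Longrightarrow>
        dgr \<Lambda> (cmp \<Lambda> \<mu> \<nu>) = dgr \<Lambda> \<mu> + dgr \<Lambda> \<nu>"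
    and factorization: "\<lbrakk>\<alpha> \<in> Mor \<Lambda>; dgr \<Lambda> \<alpha> = m + n\<rbrakk> \<Longrightarrow>
        \<exists>!p. fst p \<in> Mor \<Lambda> \<and> snd p \<in> Mor \<Lambda> \<and> src \<Lambda> (fst p) = rng \<Lambda> (snd p) \<and>
          dgr \<Lambda> (fst p) = m \<and> dgr \<Lambda> (snd p) = n \<and> \<alpha> = cmp \<Lambda> (fst p) (snd p)"

definition deg_set :: "('a, 'k::finite) kgraph \<Rightarrow> nat ^ 'k \<Rightarrow> 'a set" where
  "deg_set \<Lambda> n = {\<alpha> \<in> Mor \<Lambda>. dgr \<Lambda> \<alpha> = n}"

abbreviation vertices :: "('a, 'k::finite) kgraph \<Rightarrow> 'a set" where
  "vertices \<Lambda> \<equiv> deg_set \<Lambda> 0"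

text \<open>The vertices are exactly the objects of the category, i.e. its identity arrows.\<close>

lemma (in k_graph) vertices_eq_objects: "vertices \<Lambda> = rng \<Lambda> ` Mor \<Lambda>"
proof
  show "rng \<Lambda> ` Mor \<Lambda> \<subseteq> vertices \<Lambda>"
    using rng_in dgr_id by (auto simp: deg_set_def)
  show "vertices \<Lambda> \<subseteq> rng \<Lambda> ` Mor \<Lambda>"
  proof
    fix v assume "v \<in> vertices \<Lambda>"
    then have v: "v \<in> Mor \<Lambda>" "dgr \<Lambda> v = 0" by (auto simp: deg_set_def)
    have s: "dgr \<Lambda> (src \<Lambda> v) = 0"
      using dgr_id[OF src_in[OF v(1)]] rng_src[OF v(1)] by simp
    let ?P = "\<lambda>p. fst p \<in> Mor \<Lambda> \<and> snd p \<in> Mor \<Lambda> \<and> src \<Lambda> (fst p) = rng \<Lambda> (snd p) \<and>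
      dgr \<Lambda> (fst p) = 0 \<and> dgr \<Lambda> (snd p) = 0 \<and> v = cmp \<Lambda> (fst p) (snd p)"
    have "\<exists>!p. ?P p" using v by (intro factorization) auto
    moreover have "?P (rng \<Lambda> v, v)" "?P (v, src \<Lambda> v)"
      using v s by (simp_all add: dgr_id rng_in src_in src_rng rng_src cmp_rng cmp_src)
    ultimately have "(rng \<Lambda> v, v) = (v, src \<Lambda> v)" by blast
    then show "v \<in> rng \<Lambda> ` Mor \<Lambda>" using v(1) by (metis Pair_inject imageI)
  qed
qed

definition with_range :: "('a, 'k::finite) kgraph \<Rightarrow> 'a \<Rightarrow> 'a set \<Rightarrow> 'a set" where
  "with_range \<Lambda> v E = {\<nu> \<in> E. rng \<Lambda> \<nu> = v}"

definition finite_kgraph :: "('a, 'k::finite) kgraph \<Rightarrow> bool" where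
  "finite_kgraph \<Lambda> \<longleftrightarrow> (\<forall>n. finite (deg_set \<Lambda> n))"

abbreviation unit_deg :: "'k::finite \<Rightarrow> nat ^ 'k" where
  "unit_deg i \<equiv> axis i 1"

definition locally_convex :: "('a, 'k::finite) kgraph \<Rightarrow> bool" where
  "locally_convex \<Lambda> \<longleftrightarrow>
    (\<forall>i j. \<forall>\<alpha> \<in> deg_set \<Lambda> (unit_deg i). \<forall>\<mu> \<in> deg_set \<Lambda> (unit_deg j).
      i \<noteq> j \<and> rng \<Lambda> \<alpha> = rng \<Lambda> \<mu> \<longrightarrow>
      with_range \<Lambda> (src \<Lambda> \<alpha>) (deg_set \<Lambda> (unit_deg j)) \<noteq> {} \<and>
      with_range \<Lambda> (src \<Lambda> \<mu>) (deg_set \<Lambda> (unit_deg i)) \<noteq> {})"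

text \<open>
  A path of degree \<open>M \<in> (\<nat> \<union> {\<infinity>})\<^sup>k\<close> is a degree-preserving functor on the category whose arrows are
  the pairs \<open>(p, q)\<close> with \<open>p \<le> q \<le> M\<close>; the object \<open>p\<close> is the arrow \<open>(p, p)\<close>. It is required to be
  \<^term>\<open>undefined\<close> off these pairs, so that equal paths are equal functions.
\<close>

definition le_inf :: "nat ^ 'k::finite \<Rightarrow> enat ^ 'k \<Rightarrow> bool" where
  "le_inf p M \<longleftrightarrow> (\<chi> i. enat (p $ i)) \<le> M"

definition path_dom :: "enat ^ 'k::finite \<Rightarrow> ((nat ^ 'k) \<times> (nat ^ 'k)) set" where
  "path_dom M = {(p, q). p \<le> q \<and> le_inf q M}"

definition is_path :: "('a, 'k::finite) kgraph \<Rightarrow> enat ^ 'k \<Rightarrow> ((nat ^ 'k) \<times> (nat ^ 'k) \<Rightarrow> 'a) \<Rightarrow> bool" where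
  "is_path \<Lambda> M x \<longleftrightarrow>
    x \<in> extensional (path_dom M) \<and>
    (\<forall>(p, q) \<in> path_dom M.
      x (p, q) \<in> Mor \<Lambda> \<and> dgr \<Lambda> (x (p, q)) = q - p \<and>
      rng \<Lambda> (x (p, q)) = x (p, p) \<and> src \<Lambda> (x (p, q)) = x (q, q)) \<and>
    (\<forall>p q t. p \<le> q \<and> q \<le> t \<and> le_inf t M \<longrightarrow> x (p, t) = cmp \<Lambda> (x (p, q)) (x (q, t)))"

definition inf_deg :: "('a, 'k::finite) kgraph \<Rightarrow> 'a \<Rightarrow> enat ^ 'k" where
  "inf_deg \<Lambda> \<tau> = (\<chi> i. if dgr \<Lambda> \<tau> $ i > 0 then \<infinity> else 0)"

text \<open>The path \<open>\<tau>\<^sup>\<infinity>\<close>, for \<open>\<tau>\<close> with equal range and source.\<close>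

definition inf_path :: "('a, 'k::finite) kgraph \<Rightarrow> 'a \<Rightarrow> (nat ^ 'k) \<times> (nat ^ 'k) \<Rightarrow> 'a" where
  "inf_path \<Lambda> \<tau> =
    (THE x. is_path \<Lambda> (inf_deg \<Lambda> \<tau>) x \<and>
      (\<forall>n::nat. x (n *s dgr \<Lambda> \<tau>, (n + 1) *s dgr \<Lambda> \<tau>) = \<tau>))"

definition is_cycle :: "('a, 'k::finite) kgraph \<Rightarrow> 'a \<Rightarrow> bool" where
  "is_cycle \<Lambda> \<alpha> \<longleftrightarrow> \<alpha> \<in> Mor \<Lambda> - vertices \<Lambda> \<and> rng \<Lambda> \<alpha> = src \<Lambda> \<alpha>"

definition has_entrance :: "('a, 'k::finite) kgraph \<Rightarrow> 'a \<Rightarrow> bool" where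
  "has_entrance \<Lambda> \<alpha> \<longleftrightarrow>
    (\<exists>\<tau> \<in> with_range \<Lambda> (rng \<Lambda> \<alpha>) (Mor \<Lambda>).
      le_inf (dgr \<Lambda> \<tau>) (inf_deg \<Lambda> \<alpha>) \<and> \<tau> \<noteq> inf_path \<Lambda> \<alpha> (0, dgr \<Lambda> \<tau>))"

definition IC :: "('a, 'k::finite) kgraph \<Rightarrow> 'a set" where
  "IC \<Lambda> = {\<mu> \<in> Mor \<Lambda>. rng \<Lambda> \<mu> = src \<Lambda> \<mu> \<and>
    (\<forall>i. dgr \<Lambda> \<mu> $ i = 0 \<longrightarrow> with_range \<Lambda> (rng \<Lambda> \<mu>) (deg_set \<Lambda> (unit_deg i)) = {})}"

definition cycle_lattice :: "('a, 'k::finite) kgraph \<Rightarrow> 'a \<Rightarrow> (int ^ 'k) set" where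
  "cycle_lattice \<Lambda> \<mu> =
    (if \<mu> \<in> vertices \<Lambda> then {0}
     else {(\<chi> i. int (m $ i)) - (\<chi> i. int (n $ i)) | m n.
       le_inf m (inf_deg \<Lambda> \<mu>) \<and> le_inf n (inf_deg \<Lambda> \<mu>) \<and>
       inf_path \<Lambda> \<mu> (m, m) = inf_path \<Lambda> \<mu> (n, n)})"

definition additive_group :: "'b::ab_group_add set \<Rightarrow> 'b monoid" where
  "additive_group H = \<lparr>carrier = H, monoid.mult = (+), one = 0\<rparr>"

definition int_lattice :: "nat \<Rightarrow> (nat \<Rightarrow> int) monoid" where
  "int_lattice l = product_group {..<l} (\<lambda>_. integer_group)"

text \<open>
  The rank of a free abelian group of finite rank. The conjunct \<open>group\<close> is needed because the library's
  \<open>\<cong>\<close> asks only for a bijection preserving products and does not itself force closure of the domain.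
\<close>

definition lattice_rank :: "'b::ab_group_add set \<Rightarrow> nat" where
  "lattice_rank H = (THE l. group (additive_group H) \<and> additive_group H \<cong> int_lattice l)"

lemma int_lattice_iso_iff: "int_lattice l \<cong> int_lattice l' \<longleftrightarrow> l = l'"
proof
  have grp: "group (int_lattice l)" for l
    by (simp add: int_lattice_def)
  have free: "int_lattice l \<cong> free_Abelian_group {..<l}" for l
  proof -
    have "(\<lambda>x. x) \<in> iso (int_lattice l) (sum_group {..<l} (\<lambda>_. integer_group))"
      by (auto simp: iso_def hom_def bij_betw_def int_lattice_def carrier_sum_group)
    then have "int_lattice l \<cong> sum_group {..<l} (\<lambda>_. integer_group)"
      by (rule is_isoI)
    then show ?thesis
      using isomorphic_sum_integer_group[of "{..<l}"] iso_trans by blast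
  qed
  assume "int_lattice l \<cong> int_lattice l'"
  then have "free_Abelian_group {..<l} \<cong> free_Abelian_group {..<l'}"
    by (meson free grp group.iso_sym iso_trans)
  then have "{..<l} \<approx> {..<l'}"
    using isomorphic_free_Abelian_groups by blast
  then show "l = l'"
    by (metis card_lessThan eqpoll_iff_card finite_lessThan)
qed auto

lemma lattice_rank_eqI:
  assumes "group (additive_group H)" "additive_group H \<cong> int_lattice l"
  shows "lattice_rank H = l"
proof -
  have "l' = l" if "additive_group H \<cong> int_lattice l'" for l'
    using iso_trans[OF group.iso_sym[OF assms(1) that] assms(2)] int_lattice_iso_iff by blast
  then show ?thesis
    unfolding lattice_rank_def using assms by blast
qed

definition ell :: "('a, 'k::finite) kgraph \<Rightarrow> 'a \<Rightarrow> nat" where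
  "ell \<Lambda> \<mu> = lattice_rank (cycle_lattice \<Lambda> \<mu>)"

end

theory Submission
  imports Defs
begin

text \<open>
  Let \<open>x = \<mu>\<^sup>\<infinity>\<close>. Since the cycle \<open>\<mu>\<close> has no entrance, every path starting at \<open>r(\<mu>)\<close> whose degree is
  supported on \<open>F = {i. d(\<mu>)\<^sub>i > 0}\<close> is an initial segment of \<open>x\<close>; applied to \<open>x(0,n) x(m,m+p)\<close> this
  shows that \<open>x(m) = x(n)\<close> implies \<open>x(m+p) = x(n+p)\<close>. Hence \<open>G\<^sub>\<mu>\<close> is a subgroup of \<open>\<int>\<^sup>F\<close>. As there are only
  finitely many vertices, \<open>a \<mapsto> x(a e\<^sub>i)\<close> is not injective for \<open>i \<in> F\<close>, so \<open>G\<^sub>\<mu>\<close> contains a nonzero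
  multiple of each \<open>e\<^sub>i\<close> with \<open>i \<in> F\<close> and therefore has rank \<open>|F|\<close>.
\<close>

section \<open>Subgroups of \<open>\<int>\<^sup>k\<close>\<close>

lemma diff_closed_smult:
  fixes H :: "(int ^ 'k::finite) set"
  assumes "0 \<in> H" and diff: "\<And>x y. x \<in> H \<Longrightarrow> y \<in> H \<Longrightarrow> x - y \<in> H" and "x \<in> H"
  shows "c *s x \<in> H"
proof (induction c rule: int_induct[where k = 0])
  case base
  then show ?case using \<open>0 \<in> H\<close> by simp
next
  case (step1 i)
  have "(i + 1) *s x = i *s x - (0 - x)" by (simp add: vec_eq_iff algebra_simps)
  then show ?case using step1 assms by metis
next
  case (step2 i)
  have "(i - 1) *s x = i *s x - x" by (simp add: vec_eq_iff algebra_simps)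
  then show ?case using step2 assms by metis
qed

text \<open>Induction on \<open>F\<close>, one coordinate at a time. The values of the
  \<open>i\<close>-th coordinate on \<open>H\<close> form a nonzero subgroup of the integers,
  generated by its least positive element \<open>g\<close>. A vector \<open>h0\<close> of
  \<open>H\<close> attaining \<open>g\<close>, together with a basis of the kernel \<open>H'\<close>
  of that coordinate, is a basis of \<open>H\<close>. The multiples of unit vectors ensure that no
  coordinate in \<open>F\<close> vanishes on all of \<open>H\<close>.\<close>

lemma triangular_basis:
  fixes H :: "(int ^ 'k::finite) set"
  assumes "finite F" and "0 \<in> H"
    and "\<And>x y. x \<in> H \<Longrightarrow> y \<in> H \<Longrightarrow> x - y \<in> H"
    and "\<And>x i. x \<in> H \<Longrightarrow> i \<notin> F \<Longrightarrow> x $ i = 0"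
    and "\<And>i. i \<in> F \<Longrightarrow> \<exists>c. c \<noteq> 0 \<and> axis i c \<in> H"
  shows "\<exists>b. (\<forall>f. (\<Sum>n<card F. f n *s b n) \<in> H) \<and>
    (\<forall>x\<in>H. \<exists>f. x = (\<Sum>n<card F. f n *s b n)) \<and>
    (\<forall>f. (\<Sum>n<card F. f n *s b n) = 0 \<longrightarrow> (\<forall>n<card F. f n = 0))"
  using assms
proof (induction F arbitrary: H rule: finite_induct)
  case empty
  then have "H = {0}" by (auto simp: vec_eq_iff)
  then show ?case by simp
next
  case (insert i F)
  note zero = insert.prems(1) and diff = insert.prems(2)
  have smult: "c *s x \<in> H" if "x \<in> H" for c x
    using diff_closed_smult[OF zero diff that] .
  have add: "x + y \<in> H" if "x \<in> H" "y \<in> H" for x y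
  proof -
    have "x + y = x - (0 - y)" by simp
    then show ?thesis using that zero diff by metis
  qed
  define P where "P n \<longleftrightarrow> 0 < n \<and> (\<exists>h\<in>H. h $ i = int n)" for n
  obtain c where c: "c \<noteq> 0" "axis i c \<in> H" using insert.prems(4)[of i] by auto
  \<comment> \<open>Multiplying by the sign of \<open>c\<close> makes the coordinate positive, so
    \<open>P\<close> holds somewhere and the least \<open>n\<close> with \<open>P n\<close> is
    meaningful.\<close>
  have "P (nat \<bar>c\<bar>)"
  proof -
    have "(sgn c *s axis i c) $ i = \<bar>c\<bar>" by (simp add: axis_def abs_sgn mult.commute)
    then show ?thesis unfolding P_def using c(1) smult[OF c(2), of "sgn c"]
      by (intro conjI bexI[of _ "sgn c *s axis i c"]) simp_all
  qed
  then have "P (LEAST n. P n)" by (rule LeastI)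
  then obtain g h0 where g: "g = (LEAST n. P n)" "0 < g" and h0: "h0 \<in> H" "h0 $ i = int g"
    unfolding P_def by auto
  \<comment> \<open>Division with remainder: the left side is \<open>x $ i mod int g\<close>. A
    nonzero remainder would be a positive coordinate of an element of \<open>H\<close> below the
    minimum \<open>g\<close>.\<close>
  have reduce: "(x - (x $ i div int g) *s h0) $ i = 0" if "x \<in> H" for x
  proof (rule ccontr)
    define y where "y = x - (x $ i div int g) *s h0"
    assume "y $ i \<noteq> 0"
    moreover have yi: "y $ i = x $ i mod int g"
      by (simp add: y_def h0 minus_div_mult_eq_mod)
    moreover have "0 \<le> x $ i mod int g" "x $ i mod int g < int g" using g by auto
    moreover have "y \<in> H" unfolding y_def using that h0 by (intro diff smult)
    ultimately have "P (nat (y $ i))" "nat (y $ i) < g" unfolding P_def by (auto intro!: bexI)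
    then show False using not_less_Least g by blast
  qed
  define H' where "H' = {h \<in> H. h $ i = 0}"
  have "\<exists>b. (\<forall>f. (\<Sum>n<card F. f n *s b n) \<in> H') \<and>
    (\<forall>x\<in>H'. \<exists>f. x = (\<Sum>n<card F. f n *s b n)) \<and>
    (\<forall>f. (\<Sum>n<card F. f n *s b n) = 0 \<longrightarrow> (\<forall>n<card F. f n = 0))"
  proof (rule insert.IH)
    show "x $ j = 0" if "x \<in> H'" "j \<notin> F" for x j
      using that insert.prems(3)[of x j] by (cases "j = i") (auto simp: H'_def)
    show "\<exists>c. c \<noteq> 0 \<and> axis j c \<in> H'" if "j \<in> F" for j
    proof -
      \<comment> \<open>The vector \<open>axis j c\<close> has zero \<open>i\<close>-th entry, so
        the witness for \<open>H\<close> also serves for \<open>H'\<close>.\<close>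
      have "i \<noteq> j" using that insert.hyps by auto
      then show ?thesis using insert.prems(4)[of j] that by (auto simp: H'_def axis_def)
    qed
  qed (auto simp: H'_def zero diff)
  then obtain b where b: "\<And>f. (\<Sum>n<card F. f n *s b n) \<in> H'"
      "\<And>x. x \<in> H' \<Longrightarrow> \<exists>f. x = (\<Sum>n<card F. f n *s b n)"
      "\<And>f n. (\<Sum>n<card F. f n *s b n) = 0 \<Longrightarrow> n < card F \<Longrightarrow> f n = 0"
    by blast
  \<comment> \<open>The new vector gets the first free index, which is the last summand for
    \<open>insert i F\<close>.\<close>
  define b' where "b' = b(card F := h0)"
  have card: "card (insert i F) = Suc (card F)" using insert.hyps by simp
  have sum_b': "(\<Sum>n<card (insert i F). f n *s b' n) = (\<Sum>n<card F. f n *s b n) + f (card F) *s h0"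
    for f by (simp add: card b'_def)
  show ?case
  proof (intro exI[of _ b'] conjI allI ballI impI)
    fix f
    show "(\<Sum>n<card (insert i F). f n *s b' n) \<in> H"
      unfolding sum_b' using b(1)[of f] smult[OF h0(1)] add by (auto simp: H'_def)
  next
    fix x assume x: "x \<in> H"
    have "x - (x $ i div int g) *s h0 \<in> H'"
      using reduce[OF x] diff[OF x smult[OF h0(1)]] by (simp add: H'_def)
    then obtain f where f: "x - (x $ i div int g) *s h0 = (\<Sum>n<card F. f n *s b n)"
      using b(2) by blast
    have "x = (\<Sum>n<card (insert i F). (f(card F := x $ i div int g)) n *s b' n)"
      unfolding sum_b' using f by (simp add: algebra_simps)
    then show "\<exists>f. x = (\<Sum>n<card (insert i F). f n *s b' n)" by blast
  next
    fix f n assume s: "(\<Sum>n<card (insert i F). f n *s b' n) = 0" and n: "n < card (insert i F)"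
    \<comment> \<open>In the \<open>i\<close>-th coordinate of the relation only the multiple of
      \<open>h0\<close> survives, which forces its coefficient to vanish.\<close>
    have "(\<Sum>n<card F. f n *s b n) $ i = 0" using b(1)[of f] by (simp add: H'_def)
    then have "f (card F) * int g = 0"
      using arg_cong[OF s, of "\<lambda>v. v $ i"] unfolding sum_b' by (simp add: h0)
    then have 0: "f (card F) = 0" using g by simp
    then have "(\<Sum>n<card F. f n *s b n) = 0" using s unfolding sum_b' by simp
    then show "f n = 0" using b(3)[of f n] 0 n card less_Suc_eq by auto
  qed
qed

text \<open>The basis from \<open>triangular_basis\<close> provides coordinates: sending
  coefficients to their linear combination is an isomorphism from
  \<open>int_lattice (card F)\<close> onto \<open>H\<close>.\<close>

lemma lattice_rank_eq_card:
  fixes H :: "(int ^ 'k::finite) set"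
  assumes zero: "0 \<in> H" and diff: "\<And>x y. x \<in> H \<Longrightarrow> y \<in> H \<Longrightarrow> x - y \<in> H"
    and supp: "\<And>x i. x \<in> H \<Longrightarrow> i \<notin> F \<Longrightarrow> x $ i = 0"
    and axis: "\<And>i. i \<in> F \<Longrightarrow> \<exists>c. c \<noteq> 0 \<and> axis i c \<in> H"
  shows "lattice_rank H = card F"
proof (rule lattice_rank_eqI)
  have neg: "- x \<in> H" if "x \<in> H" for x using diff[OF zero that] by simp
  have add: "x + y \<in> H" if "x \<in> H" "y \<in> H" for x y using diff[OF that(1) neg[OF that(2)]] by simp
  show grp: "group (additive_group H)"
  proof (rule groupI)
    show "\<exists>y\<in>carrier (additive_group H). y \<otimes>\<^bsub>additive_group H\<^esub> x = \<one>\<^bsub>additive_group H\<^esub>"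
      if "x \<in> carrier (additive_group H)" for x
      using that by (intro bexI[of _ "- x"]) (simp_all add: additive_group_def neg)
  qed (auto simp: additive_group_def zero add add.assoc)
  obtain b where b: "\<And>f. (\<Sum>n<card F. f n *s b n) \<in> H"
      "\<And>x. x \<in> H \<Longrightarrow> \<exists>f. x = (\<Sum>n<card F. f n *s b n)"
      "\<And>f n. (\<Sum>n<card F. f n *s b n) = 0 \<Longrightarrow> n < card F \<Longrightarrow> f n = 0"
    using triangular_basis[of F H, OF finite zero diff supp axis] by blast
  define \<phi> where "\<phi> f = (\<Sum>n<card F. f n *s b n)" for f
  have carrier: "carrier (int_lattice (card F)) = {..<card F} \<rightarrow>\<^sub>E UNIV"
    by (simp add: int_lattice_def integer_group_def)
  have iso: "\<phi> \<in> iso (int_lattice (card F)) (additive_group H)"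
  proof (rule isoI)
    show "\<phi> \<in> hom (int_lattice (card F)) (additive_group H)"
    proof (rule homI)
      show "\<phi> f \<in> carrier (additive_group H)" for f
        by (simp add: \<phi>_def additive_group_def b(1))
      show "\<phi> (f \<otimes>\<^bsub>int_lattice (card F)\<^esub> f') = \<phi> f \<otimes>\<^bsub>additive_group H\<^esub> \<phi> f'" for f f'
        by (simp add: \<phi>_def additive_group_def int_lattice_def product_group_def
            vec_eq_iff distrib_right sum.distrib)
    qed
    have "inj_on \<phi> ({..<card F} \<rightarrow>\<^sub>E UNIV)"
    proof (rule inj_onI)
      fix f f' assume f: "f \<in> {..<card F} \<rightarrow>\<^sub>E UNIV" "f' \<in> {..<card F} \<rightarrow>\<^sub>E UNIV" "\<phi> f = \<phi> f'"
      \<comment> \<open>Independence is applied to the differences of the coefficients.\<close>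
      have "(\<Sum>n<card F. (f n - f' n) *s b n) = \<phi> f - \<phi> f'"
        by (simp add: \<phi>_def vec_eq_iff sum_subtractf left_diff_distrib)
      then have "f n = f' n" if "n < card F" for n
        using b(3)[of "\<lambda>n. f n - f' n" n] f(3) that by simp
      then show "f = f'" using f(1,2) by (intro PiE_ext) auto
    qed
    moreover have "\<phi> ` ({..<card F} \<rightarrow>\<^sub>E UNIV) = H"
    proof (intro equalityI image_subsetI subsetI)
      show "\<phi> f \<in> H" for f unfolding \<phi>_def by (rule b(1))
      fix x assume "x \<in> H"
      then obtain f where "x = \<phi> f" using b(2) unfolding \<phi>_def by blast
      \<comment> \<open>The carrier consists of functions that are \<open>undefined\<close> from
        \<open>card F\<close> on; restricting \<open>f\<close> lands there without changing the
        sum.\<close>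
      also have "\<phi> f = \<phi> (restrict f {..<card F})" by (simp add: \<phi>_def)
      finally show "x \<in> \<phi> ` ({..<card F} \<rightarrow>\<^sub>E UNIV)" by auto
    qed
    ultimately show "bij_betw \<phi> (carrier (int_lattice (card F))) (carrier (additive_group H))"
      unfolding carrier by (simp add: bij_betw_def additive_group_def)
  qed
  have "group (int_lattice (card F))" by (simp add: int_lattice_def)
  then show "additive_group H \<cong> int_lattice (card F)"
    using is_isoI[OF iso] by (rule group.iso_sym)
qed

section \<open>The infinite path of a cycle\<close>

text \<open>The entries of \<open>inf_deg\<close> are zero or infinite, and only the zero ones
  impose a bound. In this form it is evident that the admissible degrees are closed under
  addition.\<close>

lemma le_inf_inf_deg_iff: "le_inf p (inf_deg \<Lambda> \<tau>) \<longleftrightarrow> (\<forall>i. dgr \<Lambda> \<tau> $ i = 0 \<longrightarrow> p $ i = 0)"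
  by (auto simp: le_inf_def inf_deg_def less_eq_vec_def zero_enat_def)

lemma le_inf_dgr: "le_inf (dgr \<Lambda> \<tau>) (inf_deg \<Lambda> \<tau>)"
  by (simp add: le_inf_inf_deg_iff)

lemma Suc_0_smult [simp]: "Suc 0 *s v = v"
  by (simp add: vec_eq_iff)

context k_graph
begin

section \<open>Cancellation and factorization of arrows\<close>

lemma cmp_cancel:
  assumes "\<alpha> \<in> Mor \<Lambda>" "\<beta> \<in> Mor \<Lambda>" "src \<Lambda> \<alpha> = rng \<Lambda> \<beta>"
    and "\<alpha>' \<in> Mor \<Lambda>" "\<beta>' \<in> Mor \<Lambda>" "src \<Lambda> \<alpha>' = rng \<Lambda> \<beta>'"
    and "cmp \<Lambda> \<alpha> \<beta> = cmp \<Lambda> \<alpha>' \<beta>'" "dgr \<Lambda> \<alpha> = dgr \<Lambda> \<alpha>'"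
  shows "\<alpha> = \<alpha>'" "\<beta> = \<beta>'"
proof -
  \<comment> \<open>With the second degrees also equal, both pairs factor one arrow in the same
    degrees, and unique factorization identifies them.\<close>
  have "dgr \<Lambda> \<beta> = dgr \<Lambda> \<beta>'" using dgr_cmp assms by (metis add_left_cancel)
  let ?P = "\<lambda>p. fst p \<in> Mor \<Lambda> \<and> snd p \<in> Mor \<Lambda> \<and> src \<Lambda> (fst p) = rng \<Lambda> (snd p) \<and>
    dgr \<Lambda> (fst p) = dgr \<Lambda> \<alpha> \<and> dgr \<Lambda> (snd p) = dgr \<Lambda> \<beta> \<and> cmp \<Lambda> \<alpha> \<beta> = cmp \<Lambda> (fst p) (snd p)"
  have "\<exists>!p. ?P p" using assms by (intro factorization cmp_in dgr_cmp)
  moreover have "?P (\<alpha>, \<beta>)" by (simp add: assms(1-3))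
  moreover have "?P (\<alpha>', \<beta>')" using assms \<open>dgr \<Lambda> \<beta> = dgr \<Lambda> \<beta>'\<close> by simp
  ultimately have "(\<alpha>, \<beta>) = (\<alpha>', \<beta>')" by blast
  then show "\<alpha> = \<alpha>'" "\<beta> = \<beta>'" by auto
qed

lemma factorE:
  assumes "\<alpha> \<in> Mor \<Lambda>" "m \<le> dgr \<Lambda> \<alpha>"
  obtains \<beta> \<gamma> where "\<beta> \<in> Mor \<Lambda>" "\<gamma> \<in> Mor \<Lambda>" "src \<Lambda> \<beta> = rng \<Lambda> \<gamma>"
    "dgr \<Lambda> \<beta> = m" "dgr \<Lambda> \<gamma> = dgr \<Lambda> \<alpha> - m" "\<alpha> = cmp \<Lambda> \<beta> \<gamma>"
proof -
  have "dgr \<Lambda> \<alpha> = m + (dgr \<Lambda> \<alpha> - m)"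
    using assms(2) by (simp add: vec_eq_iff less_eq_vec_def)
  from factorization[OF assms(1) this] show ?thesis using that by blast
qed

lemma dgr_src: "\<alpha> \<in> Mor \<Lambda> \<Longrightarrow> dgr \<Lambda> (src \<Lambda> \<alpha>) = 0"
  using dgr_id[OF src_in] by (simp add: rng_src)

section \<open>Finite powers of a cycle and their segments\<close>

fun cycle_pow :: "'a \<Rightarrow> nat \<Rightarrow> 'a" where
  "cycle_pow \<tau> 0 = rng \<Lambda> \<tau>"
| "cycle_pow \<tau> (Suc n) = cmp \<Lambda> (cycle_pow \<tau> n) \<tau>"

text \<open>Stands for \<open>\<nu> = \<tau>\<^sup>\<infinity>(p, q)\<close>, but is phrased with
  finite powers only, so that it can be used to construct the infinite path. The exponent is left
  open; its choice does not matter by \<open>segment_unique\<close>.\<close>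

definition segment :: "'a \<Rightarrow> nat ^ 'k \<Rightarrow> nat ^ 'k \<Rightarrow> 'a \<Rightarrow> bool" where
  "segment \<tau> p q \<nu> \<longleftrightarrow> (\<exists>N \<alpha> \<beta>. \<alpha> \<in> Mor \<Lambda> \<and> \<nu> \<in> Mor \<Lambda> \<and> \<beta> \<in> Mor \<Lambda> \<and>
     src \<Lambda> \<alpha> = rng \<Lambda> \<nu> \<and> src \<Lambda> \<nu> = rng \<Lambda> \<beta> \<and> dgr \<Lambda> \<alpha> = p \<and> dgr \<Lambda> \<nu> = q - p \<and>
     cycle_pow \<tau> N = cmp \<Lambda> \<alpha> (cmp \<Lambda> \<nu> \<beta>))"

context
  fixes \<tau>
  assumes \<tau>: "\<tau> \<in> Mor \<Lambda>" "rng \<Lambda> \<tau> = src \<Lambda> \<tau>"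
begin

lemma cycle_pow_props:
  "cycle_pow \<tau> n \<in> Mor \<Lambda> \<and> rng \<Lambda> (cycle_pow \<tau> n) = rng \<Lambda> \<tau> \<and> src \<Lambda> (cycle_pow \<tau> n) = rng \<Lambda> \<tau> \<and>
    dgr \<Lambda> (cycle_pow \<tau> n) = n *s dgr \<Lambda> \<tau>"
  by (induction n) (auto simp: \<tau> rng_in src_in src_src rng_src dgr_src cmp_in rng_cmp src_cmp dgr_cmp
      vec_eq_iff)

lemma cycle_pow_add: "cycle_pow \<tau> (m + n) = cmp \<Lambda> (cycle_pow \<tau> m) (cycle_pow \<tau> n)"
proof (induction n)
  case 0
  then show ?case using cycle_pow_props[of m] cmp_src[of "cycle_pow \<tau> m"] by simp
next
  case (Suc n)
  then show ?case
    using cycle_pow_props[of m] cycle_pow_props[of n] \<tau> by (simp add: cmp_assoc)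
qed

lemma segment_unique:
  assumes "segment \<tau> p q \<nu>" "segment \<tau> p q \<nu>'"
  shows "\<nu> = \<nu>'"
proof -
  \<comment> \<open>Both factorizations can be extended to factorizations of the same power of \<open>\<tau>\<close>.\<close>
  have extend: "\<exists>\<alpha> \<beta>. \<alpha> \<in> Mor \<Lambda> \<and> \<nu> \<in> Mor \<Lambda> \<and> \<beta> \<in> Mor \<Lambda> \<and>
     src \<Lambda> \<alpha> = rng \<Lambda> \<nu> \<and> src \<Lambda> \<nu> = rng \<Lambda> \<beta> \<and> dgr \<Lambda> \<alpha> = p \<and> dgr \<Lambda> \<nu> = q - p \<and>
     cycle_pow \<tau> (N + K) = cmp \<Lambda> \<alpha> (cmp \<Lambda> \<nu> \<beta>)"
    if "\<alpha> \<in> Mor \<Lambda>" "\<nu> \<in> Mor \<Lambda>" "\<beta> \<in> Mor \<Lambda>" "src \<Lambda> \<alpha> = rng \<Lambda> \<nu>" "src \<Lambda> \<nu> = rng \<Lambda> \<beta>"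
      "dgr \<Lambda> \<alpha> = p" "dgr \<Lambda> \<nu> = q - p" "cycle_pow \<tau> N = cmp \<Lambda> \<alpha> (cmp \<Lambda> \<nu> \<beta>)" for \<alpha> \<nu> \<beta> N K
  proof -
    have \<beta>: "src \<Lambda> \<beta> = rng \<Lambda> (cycle_pow \<tau> K)"
      using that cycle_pow_props[of N] cycle_pow_props[of K] by (simp add: src_cmp cmp_in rng_cmp)
    have "cycle_pow \<tau> (N + K) = cmp \<Lambda> \<alpha> (cmp \<Lambda> \<nu> (cmp \<Lambda> \<beta> (cycle_pow \<tau> K)))"
      unfolding cycle_pow_add that(8)
      using that \<beta> cycle_pow_props[of K] by (simp add: cmp_assoc cmp_in rng_cmp src_cmp)
    then show ?thesis
      using that \<beta> cycle_pow_props[of K]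
      by (intro exI[of _ \<alpha>] exI[of _ "cmp \<Lambda> \<beta> (cycle_pow \<tau> K)"]) (simp add: cmp_in rng_cmp)
  qed
  obtain N \<alpha> \<beta> where 1: "\<alpha> \<in> Mor \<Lambda>" "\<nu> \<in> Mor \<Lambda>" "\<beta> \<in> Mor \<Lambda>" "src \<Lambda> \<alpha> = rng \<Lambda> \<nu>"
      "src \<Lambda> \<nu> = rng \<Lambda> \<beta>" "dgr \<Lambda> \<alpha> = p" "dgr \<Lambda> \<nu> = q - p"
      "cycle_pow \<tau> N = cmp \<Lambda> \<alpha> (cmp \<Lambda> \<nu> \<beta>)"
    using assms(1) unfolding segment_def by blast
  obtain N' \<alpha>' \<beta>' where 2: "\<alpha>' \<in> Mor \<Lambda>" "\<nu>' \<in> Mor \<Lambda>" "\<beta>' \<in> Mor \<Lambda>" "src \<Lambda> \<alpha>' = rng \<Lambda> \<nu>'"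
      "src \<Lambda> \<nu>' = rng \<Lambda> \<beta>'" "dgr \<Lambda> \<alpha>' = p" "dgr \<Lambda> \<nu>' = q - p"
      "cycle_pow \<tau> N' = cmp \<Lambda> \<alpha>' (cmp \<Lambda> \<nu>' \<beta>')"
    using assms(2) unfolding segment_def by blast
  obtain \<gamma> \<delta> where 3: "\<gamma> \<in> Mor \<Lambda>" "\<nu> \<in> Mor \<Lambda>" "\<delta> \<in> Mor \<Lambda>" "src \<Lambda> \<gamma> = rng \<Lambda> \<nu>"
      "src \<Lambda> \<nu> = rng \<Lambda> \<delta>" "dgr \<Lambda> \<gamma> = p" "dgr \<Lambda> \<nu> = q - p"
      "cycle_pow \<tau> (N + N') = cmp \<Lambda> \<gamma> (cmp \<Lambda> \<nu> \<delta>)"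
    using extend[OF 1, of N'] by blast
  obtain \<gamma>' \<delta>' where 4: "\<gamma>' \<in> Mor \<Lambda>" "\<nu>' \<in> Mor \<Lambda>" "\<delta>' \<in> Mor \<Lambda>" "src \<Lambda> \<gamma>' = rng \<Lambda> \<nu>'"
      "src \<Lambda> \<nu>' = rng \<Lambda> \<delta>'" "dgr \<Lambda> \<gamma>' = p" "dgr \<Lambda> \<nu>' = q - p"
      "cycle_pow \<tau> (N + N') = cmp \<Lambda> \<gamma>' (cmp \<Lambda> \<nu>' \<delta>')"
    using extend[OF 2, of N] by (auto simp: add.commute)
  \<comment> \<open>Cancellation is applied twice: first to the prefixes of degree \<open>p\<close>,
    then to the middle factors of degree \<open>q - p\<close>.\<close>
  have "cmp \<Lambda> \<nu> \<delta> = cmp \<Lambda> \<nu>' \<delta>'"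
    using cmp_cancel(2)[of \<gamma> "cmp \<Lambda> \<nu> \<delta>" \<gamma>' "cmp \<Lambda> \<nu>' \<delta>'"] 3 4 by (simp add: cmp_in rng_cmp)
  then show ?thesis using cmp_cancel(1)[of \<nu> \<delta> \<nu>' \<delta>'] 3 4 by simp
qed

lemma le_cycle_power:
  assumes "le_inf q (inf_deg \<Lambda> \<tau>)"
  obtains N where "q \<le> N *s dgr \<Lambda> \<tau>"
proof
  \<comment> \<open>The sum of all entries is an exponent that works for every coordinate: it
    dominates each \<open>q $ j\<close>, and multiplying by a positive degree keeps it large enough.
    Where the degree is zero, so is \<open>q $ j\<close>.\<close>
  show "q \<le> (\<Sum>i\<in>UNIV. q $ i) *s dgr \<Lambda> \<tau>"
    unfolding less_eq_vec_def
  proof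
    fix j
    have "q $ j \<le> (\<Sum>i\<in>UNIV. q $ i)" by (rule member_le_sum) auto
    then have "q $ j \<le> (\<Sum>i\<in>UNIV. q $ i) * dgr \<Lambda> \<tau> $ j" if "dgr \<Lambda> \<tau> $ j \<noteq> 0"
      using that by (metis Suc_leI le_trans mult.right_neutral mult_le_mono2 neq0_conv One_nat_def)
    then show "q $ j \<le> ((\<Sum>i\<in>UNIV. q $ i) *s dgr \<Lambda> \<tau>) $ j"
      using assms unfolding le_inf_inf_deg_iff by (cases "dgr \<Lambda> \<tau> $ j = 0") auto
  qed
qed

lemma le_inf_cycle_power: "le_inf (N *s dgr \<Lambda> \<tau>) (inf_deg \<Lambda> \<tau>)"
  by (simp add: le_inf_inf_deg_iff)

lemma le_inf_mono: "le_inf q (inf_deg \<Lambda> \<tau>) \<Longrightarrow> p \<le> q \<Longrightarrow> le_inf p (inf_deg \<Lambda> \<tau>)"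
  unfolding le_inf_inf_deg_iff less_eq_vec_def by (metis le_zero_eq)

text \<open>A power of degree at least \<open>q\<close> is factored twice, after \<open>p\<close>
  and then after a further \<open>q - p\<close>.\<close>

lemma segment_exists:
  assumes "p \<le> q" "le_inf q (inf_deg \<Lambda> \<tau>)"
  shows "\<exists>\<nu>. segment \<tau> p q \<nu>"
proof -
  obtain N where N: "q \<le> N *s dgr \<Lambda> \<tau>" using le_cycle_power[OF assms(2)] .
  obtain \<alpha> \<gamma> where 1: "\<alpha> \<in> Mor \<Lambda>" "\<gamma> \<in> Mor \<Lambda>" "src \<Lambda> \<alpha> = rng \<Lambda> \<gamma>"
    "dgr \<Lambda> \<alpha> = p" "dgr \<Lambda> \<gamma> = N *s dgr \<Lambda> \<tau> - p" "cycle_pow \<tau> N = cmp \<Lambda> \<alpha> \<gamma>"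
    using factorE[of "cycle_pow \<tau> N" p] cycle_pow_props[of N] assms(1) N by (metis order_trans)
  have "q - p \<le> dgr \<Lambda> \<gamma>"
    using N by (auto simp: 1 less_eq_vec_def intro!: diff_le_mono)
  then obtain \<nu> \<beta> where "\<nu> \<in> Mor \<Lambda>" "\<beta> \<in> Mor \<Lambda>" "src \<Lambda> \<nu> = rng \<Lambda> \<beta>"
    "dgr \<Lambda> \<nu> = q - p" "\<gamma> = cmp \<Lambda> \<nu> \<beta>"
    using factorE[OF 1(2)] by metis
  then have "segment \<tau> p q \<nu>"
    unfolding segment_def using 1
    by (intro exI[of _ N] exI[of _ \<alpha>] exI[of _ \<beta>]) (simp add: rng_cmp)
  then show ?thesis ..
qed

lemma segment_Mor: "segment \<tau> p q \<nu> \<Longrightarrow> \<nu> \<in> Mor \<Lambda> \<and> dgr \<Lambda> \<nu> = q - p"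
  unfolding segment_def by blast

text \<open>Factor \<open>\<nu>\<close> at degree \<open>q - p\<close>. By associativity the same
  power of the cycle exhibits both halves as segments, the other half being absorbed into the suffix
  or the prefix.\<close>

lemma segment_split:
  assumes "segment \<tau> p t \<nu>" "p \<le> q" "q \<le> t"
  shows "\<exists>\<nu>1 \<nu>2. segment \<tau> p q \<nu>1 \<and> segment \<tau> q t \<nu>2 \<and> \<nu> = cmp \<Lambda> \<nu>1 \<nu>2 \<and>
    src \<Lambda> \<nu>1 = rng \<Lambda> \<nu>2"
proof -
  obtain N \<alpha> \<beta> where 1: "\<alpha> \<in> Mor \<Lambda>" "\<nu> \<in> Mor \<Lambda>" "\<beta> \<in> Mor \<Lambda>" "src \<Lambda> \<alpha> = rng \<Lambda> \<nu>"
      "src \<Lambda> \<nu> = rng \<Lambda> \<beta>" "dgr \<Lambda> \<alpha> = p" "dgr \<Lambda> \<nu> = t - p"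
      "cycle_pow \<tau> N = cmp \<Lambda> \<alpha> (cmp \<Lambda> \<nu> \<beta>)"
    using assms(1) unfolding segment_def by blast
  have "q - p \<le> dgr \<Lambda> \<nu>" using assms by (auto simp: 1 less_eq_vec_def intro!: diff_le_mono)
  then obtain \<nu>1 \<nu>2 where 2: "\<nu>1 \<in> Mor \<Lambda>" "\<nu>2 \<in> Mor \<Lambda>" "src \<Lambda> \<nu>1 = rng \<Lambda> \<nu>2"
    "dgr \<Lambda> \<nu>1 = q - p" "dgr \<Lambda> \<nu>2 = t - p - (q - p)" "\<nu> = cmp \<Lambda> \<nu>1 \<nu>2"
    using factorE[OF 1(2)] 1(7) by metis
  have d: "p + (q - p) = q" "t - p - (q - p) = t - q"
    using assms by (auto simp: vec_eq_iff less_eq_vec_def)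
  have r: "rng \<Lambda> \<nu> = rng \<Lambda> \<nu>1" "src \<Lambda> \<nu> = src \<Lambda> \<nu>2" using 2 by (simp_all add: rng_cmp src_cmp)
  have "segment \<tau> p q \<nu>1"
    unfolding segment_def
    by (rule exI[of _ N], rule exI[of _ \<alpha>], rule exI[of _ "cmp \<Lambda> \<nu>2 \<beta>"])
      (use 1 2 r in \<open>simp add: cmp_in rng_cmp cmp_assoc\<close>)
  moreover have "segment \<tau> q t \<nu>2"
    unfolding segment_def
    by (rule exI[of _ N], rule exI[of _ "cmp \<Lambda> \<alpha> \<nu>1"], rule exI[of _ \<beta>])
      (use 1 2 r d in \<open>simp add: cmp_in rng_cmp src_cmp dgr_cmp cmp_assoc\<close>)
  ultimately show ?thesis using 2 by blast
qed

text \<open>Splitting at \<open>p\<close> itself gives a first piece of degree zero, that is, a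
  vertex, while the second piece is \<open>\<nu>\<close> by uniqueness. A vertex composable with
  \<open>\<nu>\<close> on the left is its range. Splitting at \<open>q\<close> treats sources in the
  same way.\<close>

lemma segment_rng:
  assumes "segment \<tau> p q \<nu>" "p \<le> q"
  shows "segment \<tau> p p (rng \<Lambda> \<nu>)"
proof -
  obtain \<nu>1 \<nu>2 where "segment \<tau> p p \<nu>1" "\<nu> = cmp \<Lambda> \<nu>1 \<nu>2" "segment \<tau> p q \<nu>2"
    "src \<Lambda> \<nu>1 = rng \<Lambda> \<nu>2"
    using segment_split[OF assms(1) order_refl assms(2)] by blast
  moreover from this have "\<nu>1 \<in> vertices \<Lambda>" by (auto simp: deg_set_def dest: segment_Mor)
  ultimately show ?thesis
    using segment_unique[OF assms(1)] src_rng unfolding vertices_eq_objects by fastforce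
qed

lemma segment_src:
  assumes "segment \<tau> p q \<nu>" "p \<le> q"
  shows "segment \<tau> q q (src \<Lambda> \<nu>)"
proof -
  obtain \<nu>1 \<nu>2 where "segment \<tau> p q \<nu>1" "\<nu> = cmp \<Lambda> \<nu>1 \<nu>2" "segment \<tau> q q \<nu>2"
    "src \<Lambda> \<nu>1 = rng \<Lambda> \<nu>2"
    using segment_split[OF assms(1) assms(2) order_refl] by blast
  moreover from this have "\<nu>2 \<in> vertices \<Lambda>" by (auto simp: deg_set_def dest: segment_Mor)
  ultimately show ?thesis
    using segment_unique[OF assms(1)] rng_rng unfolding vertices_eq_objects by fastforce
qed

section \<open>Existence and uniqueness of the infinite path\<close>

lemma segment_cycle: "segment \<tau> (n *s dgr \<Lambda> \<tau>) ((n + 1) *s dgr \<Lambda> \<tau>) \<tau>"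
  unfolding segment_def
  by (rule exI[of _ "Suc n"], rule exI[of _ "cycle_pow \<tau> n"], rule exI[of _ "src \<Lambda> \<tau>"])
    (use cycle_pow_props[of n] \<tau> in \<open>simp add: src_in rng_src cmp_src vec_eq_iff\<close>)

text \<open>This is the uniqueness half: segments are unique, so a path that repeats the cycle is
  determined on its whole domain.\<close>

lemma path_segment:
  assumes "is_path \<Lambda> (inf_deg \<Lambda> \<tau>) x"
    and "\<And>n::nat. x (n *s dgr \<Lambda> \<tau>, (n + 1) *s dgr \<Lambda> \<tau>) = \<tau>"
    and "p \<le> q" "le_inf q (inf_deg \<Lambda> \<tau>)"
  shows "segment \<tau> p q (x (p, q))"
proof -
  have arrow: "x (p, q) \<in> Mor \<Lambda>" "dgr \<Lambda> (x (p, q)) = q - p"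
    "rng \<Lambda> (x (p, q)) = x (p, p)" "src \<Lambda> (x (p, q)) = x (q, q)"
    if "p \<le> q" "le_inf q (inf_deg \<Lambda> \<tau>)" for p q
    using assms(1) that unfolding is_path_def path_dom_def by auto
  have comp: "x (p, t) = cmp \<Lambda> (x (p, q)) (x (q, t))"
    if "p \<le> q" "q \<le> t" "le_inf t (inf_deg \<Lambda> \<tau>)" for p q t
    using assms(1) that unfolding is_path_def by blast
  have nonneg: "0 \<le> (r :: nat ^ 'k)" for r by (simp add: less_eq_vec_def)
  have pow: "x (0, n *s dgr \<Lambda> \<tau>) = cycle_pow \<tau> n" for n
  proof (induction n)
    case 0
    \<comment> \<open>The zeroth power is a vertex, found as the range of the first copy of the
      cycle.\<close>
    have "rng \<Lambda> (x (0, dgr \<Lambda> \<tau>)) = x (0, 0)"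
      using arrow[of 0 "dgr \<Lambda> \<tau>"] nonneg by (simp add: le_inf_dgr)
    then show ?case using assms(2)[of 0] by simp
  next
    case (Suc n)
    have "n *s dgr \<Lambda> \<tau> \<le> Suc n *s dgr \<Lambda> \<tau>" by (simp add: less_eq_vec_def)
    then show ?case
      using comp[of 0 "n *s dgr \<Lambda> \<tau>" "Suc n *s dgr \<Lambda> \<tau>"] le_inf_cycle_power[of "Suc n"] nonneg
        assms(2)[of n] Suc by simp
  qed
  obtain N where N: "q \<le> N *s dgr \<Lambda> \<tau>" using le_cycle_power[OF assms(4)] .
  note L = le_inf_cycle_power[of N]
  \<comment> \<open>The power is \<open>x (0, N *s dgr \<Lambda> \<tau>)\<close>, cut by
    functoriality at \<open>p\<close> and at \<open>q\<close>.\<close>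
  have "cycle_pow \<tau> N = cmp \<Lambda> (x (0, p)) (cmp \<Lambda> (x (p, q)) (x (q, N *s dgr \<Lambda> \<tau>)))"
    using comp[of 0 p "N *s dgr \<Lambda> \<tau>"] comp[OF assms(3) N L] nonneg assms(3) N L pow
    by (metis order_trans)
  then show ?thesis
    unfolding segment_def
    using arrow[OF assms(3,4)] arrow[OF N L] arrow[OF nonneg le_inf_mono[OF assms(4,3)]]
    by (intro exI[of _ N] exI[of _ "x (0, p)"] exI[of _ "x (q, N *s dgr \<Lambda> \<tau>)"]) simp
qed

text \<open>The description in \<open>inf_path\<close> denotes something only once exactly one path
  satisfies it. The path assembled from the segments is such a path, and \<open>path_segment\<close>
  rules out any other.\<close>

lemma inf_path_props:
  "is_path \<Lambda> (inf_deg \<Lambda> \<tau>) (inf_path \<Lambda> \<tau>)"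
  "inf_path \<Lambda> \<tau> (n *s dgr \<Lambda> \<tau>, (n + 1) *s dgr \<Lambda> \<tau>) = \<tau>"
proof -
  define D where "D = path_dom (inf_deg \<Lambda> \<tau>)"
  define x where "x = restrict (\<lambda>(p, q). THE \<nu>. segment \<tau> p q \<nu>) D"
  have D: "(p, q) \<in> D \<longleftrightarrow> p \<le> q \<and> le_inf q (inf_deg \<Lambda> \<tau>)" for p q
    by (simp add: D_def path_dom_def)
  have x_eq: "x (p, q) = \<nu>" if "segment \<tau> p q \<nu>" "(p, q) \<in> D" for p q \<nu>
    using that segment_unique by (auto simp: x_def)
  have x_seg: "segment \<tau> p q (x (p, q))" if "(p, q) \<in> D" for p q
    using that segment_exists[of p q] x_eq unfolding D by metis
  have path: "is_path \<Lambda> (inf_deg \<Lambda> \<tau>) x"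
    unfolding is_path_def
  proof (intro conjI ballI allI impI)
    show "x \<in> extensional (path_dom (inf_deg \<Lambda> \<tau>))" by (simp add: x_def D_def)
    fix z assume "z \<in> path_dom (inf_deg \<Lambda> \<tau>)"
    moreover obtain p q where z: "z = (p, q)" by (cases z)
    ultimately have pq: "(p, q) \<in> D" by (simp add: D_def)
    then have "(p, p) \<in> D" "(q, q) \<in> D" "p \<le> q" using le_inf_mono by (auto simp: D)
    then have "x (p, p) = rng \<Lambda> (x (p, q))" "x (q, q) = src \<Lambda> (x (p, q))"
      using x_seg[OF pq] by (auto intro!: x_eq intro: segment_rng segment_src)
    then show "case z of (p, q) \<Rightarrow> x (p, q) \<in> Mor \<Lambda> \<and> dgr \<Lambda> (x (p, q)) = q - p \<and>
        rng \<Lambda> (x (p, q)) = x (p, p) \<and> src \<Lambda> (x (p, q)) = x (q, q)"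
      using segment_Mor[OF x_seg[OF pq]] by (simp add: z)
  next
    fix p q t assume *: "p \<le> q \<and> q \<le> t \<and> le_inf t (inf_deg \<Lambda> \<tau>)"
    then have pt: "(p, t) \<in> D" and in_D: "(p, q) \<in> D" "(q, t) \<in> D"
      using le_inf_mono by (auto simp: D)
    obtain \<nu>1 \<nu>2 where "segment \<tau> p q \<nu>1" "segment \<tau> q t \<nu>2" "x (p, t) = cmp \<Lambda> \<nu>1 \<nu>2"
      using segment_split[OF x_seg[OF pt]] * by blast
    then show "x (p, t) = cmp \<Lambda> (x (p, q)) (x (q, t))" using x_eq in_D by metis
  qed
  have cycle: "x (n *s dgr \<Lambda> \<tau>, (n + 1) *s dgr \<Lambda> \<tau>) = \<tau>" for n :: nat
    using segment_cycle le_inf_cycle_power[of "n + 1"]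
    by (intro x_eq) (auto simp: D less_eq_vec_def)
  have unique: "y = x" if "is_path \<Lambda> (inf_deg \<Lambda> \<tau>) y"
    "\<forall>n::nat. y (n *s dgr \<Lambda> \<tau>, (n + 1) *s dgr \<Lambda> \<tau>) = \<tau>" for y
  \<comment> \<open>Off the domain both functions are \<open>undefined\<close>; on it both values
    are the same segment.\<close>
  proof (rule extensionalityI)
    show "y \<in> extensional D" using that by (simp add: is_path_def D_def)
    show "x \<in> extensional D" by (simp add: x_def)
    fix z assume "z \<in> D"
    moreover obtain p q where z: "z = (p, q)" by (cases z)
    ultimately show "y z = x z"
      using path_segment[of y p q] that x_eq[of p q "y (p, q)"] by (auto simp: D)
  qed
  have "inf_path \<Lambda> \<tau> = x"
    unfolding inf_path_def
  proof (rule the_equality)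
    show "is_path \<Lambda> (inf_deg \<Lambda> \<tau>) x \<and> (\<forall>n::nat. x (n *s dgr \<Lambda> \<tau>, (n + 1) *s dgr \<Lambda> \<tau>) = \<tau>)"
      using path cycle by blast
  qed (use unique in blast)
  then show "is_path \<Lambda> (inf_deg \<Lambda> \<tau>) (inf_path \<Lambda> \<tau>)"
    "inf_path \<Lambda> \<tau> (n *s dgr \<Lambda> \<tau>, (n + 1) *s dgr \<Lambda> \<tau>) = \<tau>"
    using path cycle by simp_all
qed

lemma inf_path_arrow:
  assumes "p \<le> q" "le_inf q (inf_deg \<Lambda> \<tau>)"
  shows "inf_path \<Lambda> \<tau> (p, q) \<in> Mor \<Lambda>" "dgr \<Lambda> (inf_path \<Lambda> \<tau> (p, q)) = q - p"
    "rng \<Lambda> (inf_path \<Lambda> \<tau> (p, q)) = inf_path \<Lambda> \<tau> (p, p)"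
    "src \<Lambda> (inf_path \<Lambda> \<tau> (p, q)) = inf_path \<Lambda> \<tau> (q, q)"
  using inf_path_props(1) assms unfolding is_path_def path_dom_def by auto

lemma inf_path_start: "inf_path \<Lambda> \<tau> (0, 0) = rng \<Lambda> \<tau>"
  using inf_path_arrow(3)[of 0 "dgr \<Lambda> \<tau>"] inf_path_props(2)[of 0]
  by (simp add: le_inf_dgr less_eq_vec_def)

section \<open>The lattice of a cycle without entrance\<close>

text \<open>The vertex reached determines the continuation: as \<open>\<alpha>\<close> ends where
  \<open>\<beta>\<close> starts, their composite is a path from the range of \<open>\<tau>\<close>
  of degree \<open>n + p\<close>. Without an entrance it must be the initial segment of that degree,
  and comparing sources gives the claim.\<close>

lemma inf_path_shift:
  assumes entrance: "\<not> has_entrance \<Lambda> \<tau>"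
    and le: "le_inf m (inf_deg \<Lambda> \<tau>)" "le_inf n (inf_deg \<Lambda> \<tau>)" "le_inf p (inf_deg \<Lambda> \<tau>)"
    and eq: "inf_path \<Lambda> \<tau> (m, m) = inf_path \<Lambda> \<tau> (n, n)"
  shows "inf_path \<Lambda> \<tau> (m + p, m + p) = inf_path \<Lambda> \<tau> (n + p, n + p)"
proof -
  define \<alpha> where "\<alpha> = inf_path \<Lambda> \<tau> (0, n)"
  define \<beta> where "\<beta> = inf_path \<Lambda> \<tau> (m, m + p)"
  have nonneg: "0 \<le> (r :: nat ^ 'k)" for r by (simp add: less_eq_vec_def)
  have mp: "m \<le> m + p" by (simp add: less_eq_vec_def)
  have le': "le_inf (m + p) (inf_deg \<Lambda> \<tau>)" "le_inf (n + p) (inf_deg \<Lambda> \<tau>)"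
    using le by (auto simp: le_inf_inf_deg_iff)
  note A = inf_path_arrow[OF nonneg le(2), folded \<alpha>_def]
  note B = inf_path_arrow[OF mp le'(1), folded \<beta>_def]
  note C = inf_path_arrow[OF nonneg le'(2)]
  have ab: "src \<Lambda> \<alpha> = rng \<Lambda> \<beta>" using A B eq by simp
  have "m + p - m = p" by (simp add: vec_eq_iff)
  then have dgr: "dgr \<Lambda> (cmp \<Lambda> \<alpha> \<beta>) = n + p" using A B ab by (simp add: dgr_cmp)
  have "cmp \<Lambda> \<alpha> \<beta> \<in> with_range \<Lambda> (rng \<Lambda> \<tau>) (Mor \<Lambda>)"
    using A B ab by (simp add: with_range_def cmp_in rng_cmp inf_path_start)
  then have "cmp \<Lambda> \<alpha> \<beta> = inf_path \<Lambda> \<tau> (0, n + p)"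
    using entrance le'(2) dgr unfolding has_entrance_def by metis
  then show ?thesis using B(4) C(4) src_cmp[OF A(1) B(1) ab] by simp
qed

lemma lattice_rank_cycle_lattice:
  assumes fin: "finite (vertices \<Lambda>)" and nv: "\<tau> \<notin> vertices \<Lambda>" and entrance: "\<not> has_entrance \<Lambda> \<tau>"
  shows "lattice_rank (cycle_lattice \<Lambda> \<tau>) = card {i. dgr \<Lambda> \<tau> $ i > 0}"
proof (rule lattice_rank_eq_card)
  let ?M = "inf_deg \<Lambda> \<tau>" and ?x = "inf_path \<Lambda> \<tau>" and ?v = "\<lambda>m. (\<chi> i. int (m $ i)) :: int ^ 'k"
  have iff: "h \<in> cycle_lattice \<Lambda> \<tau> \<longleftrightarrow> (\<exists>m n. h = ?v m - ?v n \<and> le_inf m ?M \<and> le_inf n ?M \<and>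
      ?x (m, m) = ?x (n, n))" for h
    using nv by (auto simp: cycle_lattice_def)
  have zero_le: "le_inf 0 ?M" by (simp add: le_inf_inf_deg_iff)
  show "0 \<in> cycle_lattice \<Lambda> \<tau>" unfolding iff by (intro exI[of _ 0]) (simp add: zero_le)
  show "g - h \<in> cycle_lattice \<Lambda> \<tau>"
    if gh: "g \<in> cycle_lattice \<Lambda> \<tau>" "h \<in> cycle_lattice \<Lambda> \<tau>" for g h
  proof -
    obtain m n where 1: "g = ?v m - ?v n" "le_inf m ?M" "le_inf n ?M" "?x (m, m) = ?x (n, n)"
      using gh(1) iff by blast
    obtain m' n' where 2: "h = ?v m' - ?v n'" "le_inf m' ?M" "le_inf n' ?M"
        "?x (m', m') = ?x (n', n')"
      using gh(2) iff by blast
    \<comment> \<open>Both coincidences are shifted to meet at \<open>n + n'\<close>: the first by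
      \<open>n'\<close>, the second by \<open>n\<close>. The resulting coincidence of
      \<open>m + n'\<close> and \<open>n + m'\<close> represents \<open>g - h\<close>.\<close>
    have "?x (m + n', m + n') = ?x (n + n', n + n')"
      using inf_path_shift[OF entrance 1(2,3) 2(3) 1(4)] .
    also have "\<dots> = ?x (n + m', n + m')"
      using inf_path_shift[OF entrance 2(3,2) 1(3)] 2(4) by (simp add: add.commute)
    finally have "?x (m + n', m + n') = ?x (n + m', n + m')" .
    moreover have "g - h = ?v (m + n') - ?v (n + m')" by (simp add: 1 2 vec_eq_iff)
    moreover have "le_inf (m + n') ?M" "le_inf (n + m') ?M"
      using 1 2 by (auto simp: le_inf_inf_deg_iff)
    ultimately show ?thesis unfolding iff by blast
  qed
  show "h $ i = 0" if "h \<in> cycle_lattice \<Lambda> \<tau>" "i \<notin> {i. dgr \<Lambda> \<tau> $ i > 0}" for h i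
    using that unfolding iff by (auto simp: le_inf_inf_deg_iff)
  show "\<exists>c. c \<noteq> 0 \<and> axis i c \<in> cycle_lattice \<Lambda> \<tau>" if "i \<in> {i. dgr \<Lambda> \<tau> $ i > 0}" for i
  proof -
    have le: "le_inf (axis i a) ?M" for a using that by (auto simp: le_inf_inf_deg_iff axis_def)
    \<comment> \<open>Pigeonhole along the \<open>i\<close>-th axis: infinitely many positions share
      finitely many vertices, so two positions \<open>a\<close> and \<open>b\<close> carry the same
      one, and \<open>a - b\<close> is the required nonzero multiple.\<close>
    have "range (\<lambda>a. ?x (axis i a, axis i a)) \<subseteq> vertices \<Lambda>"
      using inf_path_arrow[OF order_refl le] by (auto simp: deg_set_def)
    then have "\<not> inj (\<lambda>a. ?x (axis i a, axis i a))"
      using fin finite_subset range_inj_infinite by blast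
    then obtain a b where "a \<noteq> b" "?x (axis i a, axis i a) = ?x (axis i b, axis i b)"
      by (auto simp: inj_def)
    moreover have "axis i (int a - int b) = ?v (axis i a) - ?v (axis i b)"
      by (simp add: vec_eq_iff axis_def)
    ultimately show ?thesis unfolding iff using le by (intro exI[of _ "int a - int b"]) auto
  qed
qed

end

end

theorem proposition3p3:
  fixes \<Lambda> :: "('a, 'k::finite) kgraph"
  assumes "k_graph \<Lambda>"
    and "finite_kgraph \<Lambda>"
    and "locally_convex \<Lambda>"
    and "\<not> (\<exists>\<alpha>. is_cycle \<Lambda> \<alpha> \<and> has_entrance \<Lambda> \<alpha>)"
    and "\<mu> \<in> IC \<Lambda>"
  shows "ell \<Lambda> \<mu> = card {i. dgr \<Lambda> \<mu> $ i > 0}"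
proof (cases "\<mu> \<in> vertices \<Lambda>")
  case True
  \<comment> \<open>For a vertex the lattice is \<open>{0}\<close> and the degree is zero, so both
    sides count an empty set of coordinates.\<close>
  then have "lattice_rank (cycle_lattice \<Lambda> \<mu>) = card ({} :: 'k set)"
    by (intro lattice_rank_eq_card) (auto simp: cycle_lattice_def)
  then show ?thesis using True by (simp add: ell_def deg_set_def)
next
  case False
  have "\<mu> \<in> Mor \<Lambda>" "rng \<Lambda> \<mu> = src \<Lambda> \<mu>" using assms(5) by (auto simp: IC_def)
  \<comment> \<open>An initial cycle that is not a vertex is a cycle, so the hypothesis on entrances
    applies to it.\<close>
  moreover from this have "\<not> has_entrance \<Lambda> \<mu>" using False assms(4) by (auto simp: is_cycle_def)
  ultimately show ?thesis
    using k_graph.lattice_rank_cycle_lattice[OF assms(1)] False assms(2)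
    by (simp add: ell_def finite_kgraph_def)
qed

end
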